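(* Let $s=2$, $\mathfrak N\in\mathbb N$, let $\mathcal P_{\mathfrak N}=\{t_n\}_{n=0}^{\mathfrak N}$ be a partition of $[0,t_f]$, $n\in\{0,\dots,\mathfrak N-1\}$, and $a_{11},a_{22}>0$. The solution of the two-stage DIRK scheme $$v_{n,1}=u_n+\tau_n a_{11}\mathscr F_{n,1},\qquad v_{n,2}=u_n+\tau_n(a_{21}\mathscr F_{n,1}+a_{22}\mathscr F_{n,2}),\qquad u_{n+1}=u_n+\tau_n(b_1\mathscr F_{n,1}+b_2\mathscr F_{n,2})$$ satisfies $$\tfrac12|u_{n+1}|^2+\mathcal Q(u_n,v_{n,1},v_{n,2})-\tau_n\nu_1\langle\mathscr F_{n,1},v_{n,1}\rangle-\tau_n\nu_2\langle\mathscr F_{n,2},v_{n,2}\rangle=\tfrac12|u_n|^2,$$ where $\nu_1=\nu_{11}+\nu_{12}$, $\nu_2=\nu_{22}$, and $\mathcal Q:\mathbb H^3\to\mathbb R$ is the quadratic form $$\mathcal Q(u_n,v_{n,1},v_{n,2})=\delta_1|v_{n,1}-u_n|^2+\delta_2|v_{n,2}-v_{n,1}|^2-\frac{\nu_{12}}{a_{11}}(v_{n,1}-u_n,\,v_{n,2}-v_{n,1}),$$ with $$\lambda_1=\frac{b_1}{a_{11}}-\frac{b_2a_{21}}{a_{22}a_{11}},\quad \lambda_2=\frac{b_2}{a_{22}},\quad \delta_1=\tfrac12(\lambda_1+\lambda_2)(2-\lambda_1-\lambda_2),\quad \delta_2=\tfrac12\lambda_2(2-\lambda_2),$$ $$\nu_{11}=a_{11}\left[\lambda_1(1-\lambda_2)+\lambda_2(2-\lambda_2)\right],\quad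 \nu_{22}=a_{22}\lambda_2,\quad \nu_{12}=\lambda_2\left[a_{21}+a_{11}(\lambda_1+\lambda_2-2)\right].$$
   Context: $\mathbb V\subset\mathbb H\subset\mathbb V^*$ is a Gelfand triple: $\mathbb H$ is a separable (real) Hilbert space with inner product $(\cdot,\cdot)$ and norm $|\cdot|$; $\mathbb V$ is a Banach space with dual $\mathbb V^*$ and duality pairing $\langle\cdot,\cdot\rangle$; every $v\in\mathbb H$ is identified with the element of $\mathbb V^*$ given by $\langle v,w\rangle=(v,w)$ for all $w\in\mathbb V$. Let $t_f>0$, $u_0\in\mathbb H$, $f:[0,t_f]\to\mathbb V^*$ and $\mathcal A:\mathbb V\to\mathbb V^*$; the problem approximated is $\frac{du}{dt}=f(t)-\mathcal A(u)$ on $(0,t_f]$, $u(0)=u_0$. Standing assumptions on $\mathcal A$: $\langle\mathcal A(w),w\rangle\ge0$ for all $w\in\mathbb V$, and (local solvability) for every $F\in\mathbb V^*$ there is $\beta>0$ such that for all $\gamma\in(0,\beta]$ the problem $v+\gamma\mathcal A(v)=F$ has a unique solution $v\in\mathbb V$. A partition is $0=t_0<\dots<t_{\mathfrak N}=t_f$ and $\tau_n=t_{n+1}-t_n$. The Runge-Kutta scheme has tableau with coefficient matrix $\mathbf A=[a_{ij}]$ (lower triangular, i.e. DIRK), weights $b_i\in[0,1]$ and nodes $c_i\in[0,1]$. Here $\mathscr F_{n,j}=f(t_n+c_j\tau_n)-\mathcal A(v_{n,j})$. The scheme equations hold in $\mathbb V^*$, with $u_n\in\mathbb H$, stages $v_{n,i}\in\mathbb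 V$ and $u_{n+1}\in\mathbb H$. *)

theory Defs
  imports "HOL-Analysis.Analysis"
begin

text \<open>The inclusion \<open>V \<subseteq> H\<close> is a bounded linear injection \<open>\<iota>\<close> with dense range, and the dual of \<open>V\<close>
  is the type \<open>'v \<Rightarrow>\<^sub>L real\<close>, so the duality pairing of \<open>F\<close> and \<open>w\<close> is \<open>blinfun_apply F w\<close>.\<close>

definition gelfand_triple ::
    "('v::banach \<Rightarrow>\<^sub>L 'h::{real_inner,complete_space}) \<Rightarrow> bool" where
  "gelfand_triple \<iota> \<longleftrightarrow>
     separable_space (euclidean :: 'h topology) \<and>
     inj (blinfun_apply \<iota>) \<and>
     closure (range (blinfun_apply \<iota>)) = UNIV"

text \<open>Identification of \<open>H\<close> with a subspace of the dual: the functional \<open>w \<mapsto> (h, w)\<close> on \<open>V\<close>.\<close>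

definition dual_embed ::
    "('v::banach \<Rightarrow>\<^sub>L 'h::{real_inner,complete_space}) \<Rightarrow> 'h \<Rightarrow> ('v \<Rightarrow>\<^sub>L real)" where
  "dual_embed \<iota> h = blinfun_inner_right h o\<^sub>L \<iota>"

definition nonneg_operator :: "('v::banach \<Rightarrow> ('v \<Rightarrow>\<^sub>L real)) \<Rightarrow> bool" where
  "nonneg_operator A \<longleftrightarrow> (\<forall>w. blinfun_apply (A w) w \<ge> 0)"

definition locally_solvable ::
    "('v::banach \<Rightarrow>\<^sub>L 'h::{real_inner,complete_space}) \<Rightarrow> ('v \<Rightarrow> ('v \<Rightarrow>\<^sub>L real)) \<Rightarrow> bool" where
  "locally_solvable \<iota> A \<longleftrightarrow>
     (\<forall>F. \<exists>\<beta>>0. \<forall>\<gamma>\<in>{0<..\<beta>}. \<exists>!v. dual_embed \<iota> (blinfun_apply \<iota> v) + \<gamma> *\<^sub>R A v = F)"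

definition time_partition :: "real \<Rightarrow> nat \<Rightarrow> (nat \<Rightarrow> real) \<Rightarrow> bool" where
  "time_partition t\<^sub>f N t \<longleftrightarrow> t 0 = 0 \<and> t N = t\<^sub>f \<and> (\<forall>k<N. t k < t (Suc k))"

definition time_step :: "(nat \<Rightarrow> real) \<Rightarrow> nat \<Rightarrow> real" where
  "time_step t n = t (Suc n) - t n"

text \<open>Stages are indexed by \<open>1, \<dots>, s\<close>; only these entries of \<open>a\<close>, \<open>b\<close>, \<open>c\<close> are meaningful.\<close>

definition dirk_tableau ::
    "nat \<Rightarrow> (nat \<Rightarrow> nat \<Rightarrow> real) \<Rightarrow> (nat \<Rightarrow> real) \<Rightarrow> (nat \<Rightarrow> real) \<Rightarrow> bool" where
  "dirk_tableau s a b c \<longleftrightarrow>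
     (\<forall>i\<in>{1..s}. \<forall>j\<in>{1..s}. i < j \<longrightarrow> a i j = 0) \<and>
     (\<forall>i\<in>{1..s}. b i \<in> {0..1} \<and> c i \<in> {0..1})"

definition stage_slope ::
    "(real \<Rightarrow> ('v::banach \<Rightarrow>\<^sub>L real)) \<Rightarrow> ('v \<Rightarrow> ('v \<Rightarrow>\<^sub>L real)) \<Rightarrow> (nat \<Rightarrow> real) \<Rightarrow>
     (nat \<Rightarrow> real) \<Rightarrow> (nat \<Rightarrow> nat \<Rightarrow> 'v) \<Rightarrow> nat \<Rightarrow> nat \<Rightarrow> ('v \<Rightarrow>\<^sub>L real)" where
  "stage_slope f A c t v n j = f (t n + c j * time_step t n) - A (v n j)"

definition dirk2_lambda1 :: "(nat \<Rightarrow> nat \<Rightarrow> real) \<Rightarrow> (nat \<Rightarrow> real) \<Rightarrow> real" where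
  "dirk2_lambda1 a b = b 1 / a 1 1 - (b 2 * a 2 1) / (a 2 2 * a 1 1)"

definition dirk2_lambda2 :: "(nat \<Rightarrow> nat \<Rightarrow> real) \<Rightarrow> (nat \<Rightarrow> real) \<Rightarrow> real" where
  "dirk2_lambda2 a b = b 2 / a 2 2"

definition dirk2_delta1 :: "(nat \<Rightarrow> nat \<Rightarrow> real) \<Rightarrow> (nat \<Rightarrow> real) \<Rightarrow> real" where
  "dirk2_delta1 a b =
     1/2 * (dirk2_lambda1 a b + dirk2_lambda2 a b) * (2 - dirk2_lambda1 a b - dirk2_lambda2 a b)"

definition dirk2_delta2 :: "(nat \<Rightarrow> nat \<Rightarrow> real) \<Rightarrow> (nat \<Rightarrow> real) \<Rightarrow> real" where
  "dirk2_delta2 a b = 1/2 * dirk2_lambda2 a b * (2 - dirk2_lambda2 a b)"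

definition dirk2_nu11 :: "(nat \<Rightarrow> nat \<Rightarrow> real) \<Rightarrow> (nat \<Rightarrow> real) \<Rightarrow> real" where
  "dirk2_nu11 a b =
     a 1 1 * (dirk2_lambda1 a b * (1 - dirk2_lambda2 a b)
              + dirk2_lambda2 a b * (2 - dirk2_lambda2 a b))"

definition dirk2_nu22 :: "(nat \<Rightarrow> nat \<Rightarrow> real) \<Rightarrow> (nat \<Rightarrow> real) \<Rightarrow> real" where
  "dirk2_nu22 a b = a 2 2 * dirk2_lambda2 a b"

definition dirk2_nu12 :: "(nat \<Rightarrow> nat \<Rightarrow> real) \<Rightarrow> (nat \<Rightarrow> real) \<Rightarrow> real" where
  "dirk2_nu12 a b =
     dirk2_lambda2 a b * (a 2 1 + a 1 1 * (dirk2_lambda1 a b + dirk2_lambda2 a b - 2))"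

definition dirk2_nu1 :: "(nat \<Rightarrow> nat \<Rightarrow> real) \<Rightarrow> (nat \<Rightarrow> real) \<Rightarrow> real" where
  "dirk2_nu1 a b = dirk2_nu11 a b + dirk2_nu12 a b"

definition dirk2_nu2 :: "(nat \<Rightarrow> nat \<Rightarrow> real) \<Rightarrow> (nat \<Rightarrow> real) \<Rightarrow> real" where
  "dirk2_nu2 a b = dirk2_nu22 a b"

definition dirk2_Q ::
    "(nat \<Rightarrow> nat \<Rightarrow> real) \<Rightarrow> (nat \<Rightarrow> real) \<Rightarrow> 'h::real_inner \<Rightarrow> 'h \<Rightarrow> 'h \<Rightarrow> real" where
  "dirk2_Q a b x y z =
     dirk2_delta1 a b * (norm (y - x))\<^sup>2 + dirk2_delta2 a b * (norm (z - y))\<^sup>2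
     - dirk2_nu12 a b / a 1 1 * ((y - x) \<bullet> (z - y))"

end

(* Density of V in H makes the embedding of H into the dual injective, so the last equation of the
   scheme, after eliminating the slopes, reads u' = u + \<lambda>\<^sub>1 (v\<^sub>1 - u) + \<lambda>\<^sub>2 (v\<^sub>2 - u) in H.
   The first two equations, tested with v\<^sub>1 and v\<^sub>2, express the pairings of the slopes with the stages
   by inner products. The claim is then an identity between quadratic forms in
   u, v\<^sub>1 - u and v\<^sub>2 - v\<^sub>1. *)

theory Submission
  imports Defs
begin

lemma dual_embed_apply [simp]: "blinfun_apply (dual_embed \<iota> h) w = h \<bullet> blinfun_apply \<iota> w"
  by (simp add: dual_embed_def)

lemma dual_embed_add: "dual_embed \<iota> (x + y) = dual_embed \<iota> x + dual_embed \<iota> y"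
  by (rule blinfun_eqI) (simp add: blinfun.bilinear_simps inner_add_left)

lemma dual_embed_diff: "dual_embed \<iota> (x - y) = dual_embed \<iota> x - dual_embed \<iota> y"
  by (rule blinfun_eqI) (simp add: blinfun.bilinear_simps inner_diff_left)

lemma dual_embed_scaleR: "dual_embed \<iota> (r *\<^sub>R x) = r *\<^sub>R dual_embed \<iota> x"
  by (rule blinfun_eqI) (simp add: blinfun.bilinear_simps)

text \<open>If two vectors induce the same functional, their difference is orthogonal to the range
  of \<open>\<iota>\<close>. The orthogonal complement of a vector is closed, so density makes the
  difference orthogonal to itself.\<close>

lemma inj_dual_embed:
  assumes "closure (range (blinfun_apply \<iota>)) = UNIV"
  shows "inj (dual_embed \<iota>)"
proof (rule injI)
  fix x y assume eq: "dual_embed \<iota> x = dual_embed \<iota> y"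
  have "range (blinfun_apply \<iota>) \<subseteq> {z. (x - y) \<bullet> z = 0}"
    using arg_cong[OF eq, of "\<lambda>F. blinfun_apply F w" for w]
    by (auto simp: inner_diff_left)
  then have "closure (range (blinfun_apply \<iota>)) \<subseteq> {z. (x - y) \<bullet> z = 0}"
    by (rule closure_minimal) (rule closed_hyperplane)
  then have "(x - y) \<bullet> (x - y) = 0"
    using assms by blast
  then show "x = y" by simp
qed

text \<open>All terms with a product of two lambdas, and the terms
  \<open>2 * a 1 1 * dirk2_lambda2 a b\<close>, cancel between \<open>dirk2_nu11\<close> and
  \<open>dirk2_nu12\<close>.\<close>

lemma dirk2_nu1_eq:
  assumes "a 1 1 \<noteq> 0"
  shows "dirk2_nu1 a b = a 1 1 * dirk2_lambda1 a b + a 2 1 * dirk2_lambda2 a b"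
  by (simp add: dirk2_nu1_def dirk2_nu11_def dirk2_nu12_def algebra_simps)

text \<open>The pair of lambdas is the row vector b A^{-1} for the lower triangular 2 by 2
  coefficient matrix A. Hence X = A G gives b G = (b A^{-1}) X. The lemma is applied in the dual of
  V, where the slopes live.\<close>

lemma dirk2_increment_eq:
  fixes G1 G2 X1 X2 :: "'a::real_vector"
  assumes "a 1 1 \<noteq> 0" "a 2 2 \<noteq> 0"
    and X1: "X1 = a 1 1 *\<^sub>R G1"
    and X2: "X2 = a 2 1 *\<^sub>R G1 + a 2 2 *\<^sub>R G2"
  shows "b 1 *\<^sub>R G1 + b 2 *\<^sub>R G2 = dirk2_lambda1 a b *\<^sub>R X1 + dirk2_lambda2 a b *\<^sub>R X2"
proof -
  have "dirk2_lambda1 a b * a 1 1 + dirk2_lambda2 a b * a 2 1 = b 1"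
    and "dirk2_lambda2 a b * a 2 2 = b 2"
    using assms(1,2) by (simp_all add: dirk2_lambda1_def dirk2_lambda2_def field_simps)
  then show ?thesis
    unfolding X1 X2
    by (metis (no_types, lifting) add.assoc scaleR_add_left scaleR_add_right scaleR_scaleR)
qed

text \<open>Here \<open>g1\<close> and \<open>g2\<close> stand for the time step times the pairing
  of each slope with its own stage. The first term on the right of the second assumption is the
  pairing of slope 1 with stage 2, already rewritten by the first stage equation.\<close>

lemma dirk2_energy_identity:
  fixes u v1 v2 :: "'h::real_inner" and g1 g2 :: real
  assumes a: "a 1 1 \<noteq> 0"
    and g1: "(v1 - u) \<bullet> v1 = a 1 1 * g1"
    and g2: "(v2 - u) \<bullet> v2 = a 2 1 / a 1 1 * ((v1 - u) \<bullet> v2) + a 2 2 * g2"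
  shows "1/2 * (norm (u + dirk2_lambda1 a b *\<^sub>R (v1 - u) + dirk2_lambda2 a b *\<^sub>R (v2 - u)))\<^sup>2
           + dirk2_Q a b u v1 v2 - dirk2_nu1 a b * g1 - dirk2_nu2 a b * g2
         = 1/2 * (norm u)\<^sup>2"
proof -
  define x y where "x = v1 - u" and "y = v2 - v1"
  \<comment> \<open>This ratio is the weight with which the first stage increment enters the second
    stage equation once slope 1 is eliminated.\<close>
  define r where "r = a 2 1 / a 1 1"
  define l m where "l = dirk2_lambda1 a b" and "m = dirk2_lambda2 a b"
  have v1: "v1 = u + x" and v2: "v2 = u + x + y" by (simp_all add: x_def y_def)
  have "dirk2_nu1 a b * g1 = (l + r * m) * (a 1 1 * g1)"
    using a by (simp add: dirk2_nu1_eq r_def l_def m_def algebra_simps)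
  also have "a 1 1 * g1 = x \<bullet> (u + x)"
    using g1 by (simp add: v1)
  finally have n1: "dirk2_nu1 a b * g1 = (l + r * m) * (x \<bullet> (u + x))" .
  have "dirk2_nu2 a b * g2 = m * (a 2 2 * g2)"
    by (simp add: dirk2_nu2_def dirk2_nu22_def m_def)
  also have "a 2 2 * g2 = (x + y) \<bullet> (u + x + y) - r * (x \<bullet> (u + x + y))"
    using g2 by (simp add: v1 v2 r_def add.assoc)
  finally have n2: "dirk2_nu2 a b * g2 =
      m * ((x + y) \<bullet> (u + x + y) - r * (x \<bullet> (u + x + y)))" .
  have "dirk2_nu12 a b / a 1 1 = m * (r + l + m - 2)"
    using a by (simp add: dirk2_nu12_def r_def l_def m_def field_simps)
  then have Q: "dirk2_Q a b u v1 v2 =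
      1/2 * (l + m) * (2 - l - m) * (x \<bullet> x) + 1/2 * m * (2 - m) * (y \<bullet> y)
      - m * (r + l + m - 2) * (x \<bullet> y)"
    by (simp add: dirk2_Q_def dirk2_delta1_def dirk2_delta2_def power2_norm_eq_inner
        x_def y_def l_def m_def)
  have u': "u + l *\<^sub>R (v1 - u) + m *\<^sub>R (v2 - u) = u + (l + m) *\<^sub>R x + m *\<^sub>R y"
    by (simp add: v1 v2 algebra_simps)
  show ?thesis
    \<comment> \<open>After expansion, \<open>1/2 * (norm u)\<^sup>2\<close> remains, and the
      coefficients of the other products cancel: \<open>l + m\<close> for (x,u) and (x,x),
      \<open>m\<close> for (y,u) and (y,y), \<open>m * (2 - r)\<close> for (x,y).\<close>
    unfolding n1 n2 Q l_def[symmetric] m_def[symmetric] u' power2_norm_eq_inner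
    by (simp add: inner_add_left inner_add_right inner_commute field_simps)
qed

theorem corollary4p5:
  fixes \<iota> :: "'v::banach \<Rightarrow>\<^sub>L 'h::{real_inner,complete_space}"
    and A :: "'v \<Rightarrow> ('v \<Rightarrow>\<^sub>L real)"
    and f :: "real \<Rightarrow> ('v \<Rightarrow>\<^sub>L real)"
    and t\<^sub>f :: real and N n :: nat and t :: "nat \<Rightarrow> real"
    and a :: "nat \<Rightarrow> nat \<Rightarrow> real" and b c :: "nat \<Rightarrow> real"
    and u\<^sub>0 :: 'h and u :: "nat \<Rightarrow> 'h" and v :: "nat \<Rightarrow> nat \<Rightarrow> 'v"
  assumes "gelfand_triple \<iota>"
    and "nonneg_operator A"
    and "locally_solvable \<iota> A"
    and "t\<^sub>f > 0"
    and "time_partition t\<^sub>f N t"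
    and "n < N"
    and "dirk_tableau 2 a b c"
    and "a 1 1 > 0" and "a 2 2 > 0"
    and "u 0 = u\<^sub>0"
    and "dual_embed \<iota> (blinfun_apply \<iota> (v n 1)) =
           dual_embed \<iota> (u n) + (time_step t n * a 1 1) *\<^sub>R stage_slope f A c t v n 1"
    and "dual_embed \<iota> (blinfun_apply \<iota> (v n 2)) =
           dual_embed \<iota> (u n) + time_step t n *\<^sub>R
             (a 2 1 *\<^sub>R stage_slope f A c t v n 1 + a 2 2 *\<^sub>R stage_slope f A c t v n 2)"
    and "dual_embed \<iota> (u (Suc n)) =
           dual_embed \<iota> (u n) + time_step t n *\<^sub>R
             (b 1 *\<^sub>R stage_slope f A c t v n 1 + b 2 *\<^sub>R stage_slope f A c t v n 2)"
  shows "1/2 * (norm (u (Suc n)))\<^sup>2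
           + dirk2_Q a b (u n) (blinfun_apply \<iota> (v n 1)) (blinfun_apply \<iota> (v n 2))
           - time_step t n * dirk2_nu1 a b * blinfun_apply (stage_slope f A c t v n 1) (v n 1)
           - time_step t n * dirk2_nu2 a b * blinfun_apply (stage_slope f A c t v n 2) (v n 2)
         = 1/2 * (norm (u n))\<^sup>2"
proof -
  \<comment> \<open>Absorbing the time step into the slopes leaves stage equations that involve only
    the tableau.\<close>
  define G where "G j = time_step t n *\<^sub>R stage_slope f A c t v n j" for j
  define p where "p j = blinfun_apply \<iota> (v n j)" for j
  have a: "a 1 1 \<noteq> 0" "a 2 2 \<noteq> 0" using \<open>a 1 1 > 0\<close> \<open>a 2 2 > 0\<close> by simp_all
  have e1: "dual_embed \<iota> (p 1 - u n) = a 1 1 *\<^sub>R G 1"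
    using assms(11) by (simp add: dual_embed_diff G_def p_def mult.commute)
  have e2: "dual_embed \<iota> (p 2 - u n) = a 2 1 *\<^sub>R G 1 + a 2 2 *\<^sub>R G 2"
    using assms(12) by (simp add: dual_embed_diff G_def p_def scaleR_add_right mult.commute)
  have "dual_embed \<iota> (u (Suc n)) = dual_embed \<iota> (u n) + (b 1 *\<^sub>R G 1 + b 2 *\<^sub>R G 2)"
    using assms(13) by (simp add: G_def scaleR_add_right mult.commute)
  also have "\<dots> = dual_embed \<iota>
      (u n + dirk2_lambda1 a b *\<^sub>R (p 1 - u n) + dirk2_lambda2 a b *\<^sub>R (p 2 - u n))"
    unfolding dirk2_increment_eq[of a, OF a e1 e2]
    by (simp add: dual_embed_add dual_embed_scaleR)
  finally have u': "u (Suc n) =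
      u n + dirk2_lambda1 a b *\<^sub>R (p 1 - u n) + dirk2_lambda2 a b *\<^sub>R (p 2 - u n)"
    using \<open>gelfand_triple \<iota>\<close> by (auto simp: gelfand_triple_def dest: inj_dual_embed injD)
  \<comment> \<open>The test vector stays arbitrary because both stages are inserted:
    \<open>v n 1\<close> for the first energy relation, \<open>v n 2\<close> for the cross pairing
    in the second.\<close>
  have t1: "(p 1 - u n) \<bullet> blinfun_apply \<iota> w = a 1 1 * blinfun_apply (G 1) w" for w
    using arg_cong[OF e1, of "\<lambda>F. blinfun_apply F w"] by (simp add: blinfun.bilinear_simps)
  have "(p 2 - u n) \<bullet> p 2 = a 2 1 * blinfun_apply (G 1) (v n 2) + a 2 2 * blinfun_apply (G 2) (v n 2)"
    using arg_cong[OF e2, of "\<lambda>F. blinfun_apply F (v n 2)"]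
    by (simp add: blinfun.bilinear_simps p_def)
  then have t2: "(p 2 - u n) \<bullet> p 2 =
      a 2 1 / a 1 1 * ((p 1 - u n) \<bullet> p 2) + a 2 2 * blinfun_apply (G 2) (v n 2)"
    using a t1[of "v n 2"] by (simp add: p_def)
  show ?thesis
    using dirk2_energy_identity[of a "p 1" "u n" _ "p 2", OF a(1) t1[of "v n 1", folded p_def] t2, of b]
    unfolding u'[symmetric]
    by (simp add: G_def p_def blinfun.bilinear_simps mult_ac)
qed

end
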